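(* Let $G=(V,E)$ be a connected graph on $n\ge 3$ vertices. Suppose there exist an injective map $\phi:V\to\mathbb{R}^3$, two distinct coordinate planes of $\mathbb{R}^3$, and a decomposition $E=E_1\cup E_2$ such that the projections of $\phi$ onto these two planes are injective on $V$ and, with edges drawn as straight-line segments between projected endpoints, form straight-line planar embeddings of $(V,E_1)$ and $(V,E_2)$ respectively. Then $|E|\le 6n-15$.
   Context: The coordinate planes of $\mathbb{R}^3$ are the $XY$, $YZ$ and $ZX$ planes; projection onto the $XY$ plane maps $(x,y,z)\mapsto(x,y)$, and similarly for the others. *)

theory Defs
  imports "HOL-Analysis.Analysis"
begin

text \<open>An undirected edge is a two-element set of vertices, so loops and multiple edges are excluded.\<close>

definition simple_graph :: "'a set \<Rightarrow> 'a set set \<Rightarrow> bool" where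
  "simple_graph V E \<longleftrightarrow> finite V \<and> (\<forall>e\<in>E. e \<subseteq> V \<and> card e = 2)"

definition connected_graph :: "'a set \<Rightarrow> 'a set set \<Rightarrow> bool" where
  "connected_graph V E \<longleftrightarrow>
     simple_graph V E \<and> V \<noteq> {} \<and> (\<forall>u\<in>V. \<forall>v\<in>V. (u, v) \<in> {(x, y). {x, y} \<in> E}\<^sup>*)"

datatype coord_plane = XY | YZ | ZX

fun plane_proj :: "coord_plane \<Rightarrow> real ^ 3 \<Rightarrow> real \<times> real" where
  "plane_proj XY p = (p $ 1, p $ 2)"
| "plane_proj YZ p = (p $ 2, p $ 3)"
| "plane_proj ZX p = (p $ 3, p $ 1)"

text \<open>For an edge \<open>e = {u, v}\<close> this is \<open>closed_segment (f u) (f v)\<close>, see \<open>segment_convex_hull\<close>.\<close>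

definition edge_segment :: "('a \<Rightarrow> real \<times> real) \<Rightarrow> 'a set \<Rightarrow> (real \<times> real) set" where
  "edge_segment f e = convex hull (f ` e)"

text \<open>The condition on vertices is not implied by the one on pairs of edges, since an isolated
  vertex could otherwise lie on an edge.\<close>

definition straight_line_embedding ::
  "'a set \<Rightarrow> 'a set set \<Rightarrow> ('a \<Rightarrow> real \<times> real) \<Rightarrow> bool" where
  "straight_line_embedding V E f \<longleftrightarrow>
     inj_on f V \<and>
     (\<forall>e\<in>E. \<forall>v\<in>V. f v \<in> edge_segment f e \<longrightarrow> v \<in> e) \<and>
     (\<forall>e\<in>E. \<forall>e'\<in>E. e \<noteq> e' \<longrightarrow> edge_segment f e \<inter> edge_segment f e' = f ` (e \<inter> e'))"

end

theory Submission
  imports Defs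
begin

text \<open>The two planes share a coordinate \<open>x\<close>, and a small perturbation makes the values of \<open>x\<close>
  distinct, so that a drawing becomes a set of chords over a finite set \<open>S\<close> of \<open>n\<close> reals.

  In one drawing, at most \<open>n - 1\<close> edges are topmost among the edges going right from their left
  endpoint. Every other edge bounds a wedge from below; it is charged to the first vertex \<open>m\<close> met
  inside this wedge, more precisely to the upper or the lower side of \<open>m\<close>. The charging is
  injective, and an edge passes over (under) every \<open>m\<close> whose upper (lower) side is charged. Unless
  the extreme vertices \<open>l\<close> and \<open>r\<close> are joined, some inner vertex has no edge above it and some inner
  vertex has no edge below it, so there are at most \<open>(n - 1) + 2 (n - 2) - 2 = 3 n - 7\<close> edges.

  The edge from \<open>l\<close> to the second vertex and the edge from the penultimate vertex to \<open>r\<close> can be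
  added to both drawings. Removing the edge \<open>l r\<close> from both leaves two drawings with at most
  \<open>3 n - 7\<close> edges each and, if \<open>n \<ge> 4\<close>, at least two edges in common, whence
  \<open>|E| \<le> 2 (3 n - 7) - 2 + 1 = 6 n - 15\<close>.\<close>

section \<open>Lines through two points of a graph\<close>

definition slope :: "(real \<Rightarrow> real) \<Rightarrow> real \<Rightarrow> real \<Rightarrow> real" where
  "slope y a b = (y b - y a) / (b - a)"

text \<open>The whole line through the two points, not only its part over \<open>[a, b]\<close>, so
  that edges with a common endpoint can be compared beyond the end of the shorter one.\<close>

definition chord :: "(real \<Rightarrow> real) \<Rightarrow> real \<Rightarrow> real \<Rightarrow> real \<Rightarrow> real" where
  "chord y a b t = y a + slope y a b * (t - a)"

lemma chord_left [simp]: "chord y a b a = y a"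
  by (simp add: chord_def)

lemma chord_right [simp]: "a < b \<Longrightarrow> chord y a b b = y b"
  by (simp add: chord_def slope_def)

lemma chord_uminus: "chord (\<lambda>s. - y s) a b t = - chord y a b t"
proof -
  have "slope (\<lambda>s. - y s) a b = - slope y a b"
    unfolding slope_def minus_divide_left by simp
  thus ?thesis by (simp add: chord_def)
qed

lemma chord_less_iff:
  "v < t \<Longrightarrow> chord y v a t < chord y v b t \<longleftrightarrow> slope y v a < slope y v b"
  by (simp add: chord_def)

text \<open>The difference of two lines is affine, so a change of sign forces a zero strictly
  between the two arguments.\<close>

lemma chords_cross:
  assumes "chord y a b t < chord y c d t" "chord y c d u < chord y a b u"
  obtains s where "min t u < s" "s < max t u" "chord y a b s = chord y c d s"
proof -
  define q where "q = slope y a b - slope y c d"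
  define p where "p = y a - slope y a b * a - (y c - slope y c d * c)"
  have g: "chord y a b s - chord y c d s = p + q * s" for s
    by (simp add: chord_def p_def q_def algebra_simps)
  have neg: "p + q * t < 0" and pos: "p + q * u > 0"
    using assms g[of t] g[of u] by linarith+
  hence q0: "q \<noteq> 0" by auto
  define s where "s = - p / q"
  have "p + q * s = 0" using q0 by (simp add: s_def)
  hence eq: "chord y a b s = chord y c d s" using g[of s] by linarith
  have "t < s \<and> s < u \<or> u < s \<and> s < t"
  proof (cases "q > 0")
    case True
    thus ?thesis using neg pos by (auto simp: s_def field_simps)
  next
    case False
    hence "q < 0" using q0 by simp
    thus ?thesis using neg pos by (auto simp: s_def field_simps)
  qed
  hence "min t u < s \<and> s < max t u" by auto
  thus thesis using eq that by blast
qed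

lemma chord_mem_segment:
  assumes "a < b" "a \<le> t" "t \<le> b"
  shows "(t, chord y a b t) \<in> closed_segment (a, y a) (b, y b)"
proof -
  define u where "u = (t - a) / (b - a)"
  have "0 \<le> u" "u \<le> 1" using assms by (auto simp: u_def field_simps)
  moreover have ub: "u * (b - a) = t - a" using assms by (simp add: u_def)
  have "chord y a b t = y a + (y b - y a) * u"
    by (simp add: chord_def slope_def u_def)
  hence "(t, chord y a b t) = (1 - u) *\<^sub>R (a, y a) + u *\<^sub>R (b, y b)"
    using ub by (simp add: algebra_simps)
  ultimately show ?thesis by (auto simp: closed_segment_def)
qed

section \<open>Drawings with distinct abscissas and the vertical order of their edges\<close>

text \<open>Vertices are identified with their abscissas and edges are pairs directed from left to
  right. Edges with a common endpoint get no condition of their own: an overlap would already put a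
  vertex in the interior of an edge.\<close>

locale plane_drawing =
  fixes S :: "real set" and F :: "(real \<times> real) set" and y :: "real \<Rightarrow> real"
  assumes finite_S: "finite S"
    and edge_bounds: "(a, b) \<in> F \<Longrightarrow> a \<in> S \<and> b \<in> S \<and> a < b"
    and vertex_off_edge: "(a, b) \<in> F \<Longrightarrow> c \<in> S \<Longrightarrow> a < c \<Longrightarrow> c < b \<Longrightarrow> chord y a b c \<noteq> y c"
    and disjoint_edges: "(a, b) \<in> F \<Longrightarrow> (c, d) \<in> F \<Longrightarrow> {a, b} \<inter> {c, d} = {} \<Longrightarrow>
      a \<le> t \<Longrightarrow> t \<le> b \<Longrightarrow> c \<le> t \<Longrightarrow> t \<le> d \<Longrightarrow> chord y a b t \<noteq> chord y c d t"
begin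

lemma finite_F: "finite F"
proof (rule finite_subset)
  show "F \<subseteq> S \<times> S" using edge_bounds by auto
qed (simp add: finite_S)

lemma reflect: "plane_drawing S F (\<lambda>s. - y s)"
proof
  fix a b c assume "(a, b) \<in> F" "c \<in> S" "a < c" "c < b"
  thus "chord (\<lambda>s. - y s) a b c \<noteq> - y c"
    using vertex_off_edge by (simp add: chord_uminus)
next
  fix a b c d t assume "(a, b) \<in> F" "(c, d) \<in> F" "{a, b} \<inter> {c, d} = {}"
    "a \<le> t" "t \<le> b" "c \<le> t" "t \<le> d"
  thus "chord (\<lambda>s. - y s) a b t \<noteq> chord (\<lambda>s. - y s) c d t"
    using disjoint_edges[of a b c d t] by (simp only: chord_uminus neg_equal_iff_equal) simp
qed (use finite_S edge_bounds in auto)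

lemma subset:
  assumes "F' \<subseteq> F" shows "plane_drawing S F' y"
proof
  fix a b c d t assume "(a, b) \<in> F'" "(c, d) \<in> F'" "{a, b} \<inter> {c, d} = {}"
    "a \<le> t" "t \<le> b" "c \<le> t" "t \<le> d"
  thus "chord y a b t \<noteq> chord y c d t"
    using assms disjoint_edges[of a b c d t] by blast
qed (use assms finite_S edge_bounds vertex_off_edge in blast)+

lemma chord_through_edge:
  assumes "(a, b) \<in> F" "c \<in> S" "a < c" "c \<le> b" "chord y a b c = y c"
  shows "c = b"
  using vertex_off_edge[of a b c] assms by force

text \<open>Two edges of equal slope leave \<open>v\<close> along one line, so if they differed, the
  nearer of their right endpoints would be an inner point of the other edge.\<close>

lemma fan_slope_inject:
  assumes "(v, a) \<in> F" "(v, b) \<in> F" "slope y v a = slope y v b"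
  shows "a = b"
proof -
  have ab: "v < a" "a \<in> S" "v < b" "b \<in> S" using edge_bounds assms by auto
  have "chord y v b a = y a" "chord y v a b = y b"
    using assms(3) ab chord_right[of v a y] chord_right[of v b y] by (simp_all add: chord_def)
  thus ?thesis
    using chord_through_edge[of v b a] chord_through_edge[of v a b] assms ab by linarith
qed

text \<open>Two lines through the point over \<open>v\<close> that agree at some
  \<open>t < v\<close> coincide, and then \<open>b\<close> would lie inside the edge from
  \<open>a\<close> to \<open>v\<close>.\<close>

lemma cofan_distinct:
  assumes "(a, v) \<in> F" "(b, v) \<in> F" "a < b" "t < v"
  shows "chord y a v t \<noteq> chord y b v t"
proof
  assume eq: "chord y a v t = chord y b v t"
  have bv: "b < v" "a < v" "b \<in> S" using edge_bounds assms by auto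
  have rw: "chord y c v s = y v + slope y c v * (s - v)" if "c < v" for c s
    using chord_right[OF that, of y] by (simp add: chord_def algebra_simps)
  have "slope y a v = slope y b v"
    using eq bv assms(4) by (simp add: rw)
  hence "chord y a v b = chord y b v b"
    using bv by (simp only: rw)
  thus False using vertex_off_edge[of a v b] assms bv by simp
qed

lemma edges_distinct_inside:
  assumes e: "(a, b) \<in> F" "(c, d) \<in> F" "(a, b) \<noteq> (c, d)"
    and t: "a < t" "t < b" "c < t" "t < d"
  shows "chord y a b t \<noteq> chord y c d t"
proof -
  \<comment> \<open>Since \<open>t\<close> is strictly inside both ranges, neither edge can end
    where the other begins.\<close>
  consider "a = c" | "b = d" | "{a, b} \<inter> {c, d} = {}" using t by auto
  thus ?thesis
  proof cases
    case 1
    thus ?thesis using fan_slope_inject[of a b d] e t by (auto simp: chord_def)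
  next
    case 2
    hence "a < c \<or> c < a" using e by auto
    thus ?thesis using cofan_distinct[of a b c t] cofan_distinct[of c b a t] e t 2 by metis
  next
    case 3
    thus ?thesis using disjoint_edges[of a b c d t] e t by simp
  qed
qed

text \<open>A reversal would force a crossing strictly between \<open>t\<close> and
  \<open>u\<close>, hence inside both ranges. The conclusion is not strict because the edges may
  meet in a common endpoint over \<open>u\<close>.\<close>

lemma edge_order_persists:
  assumes e: "(a, b) \<in> F" "(c, d) \<in> F"
    and t: "a \<le> t" "t \<le> b" "c \<le> t" "t \<le> d"
    and u: "a \<le> u" "u \<le> b" "c \<le> u" "u \<le> d"
    and less: "chord y a b t < chord y c d t"
  shows "chord y a b u \<le> chord y c d u"
proof (rule ccontr)
  assume "\<not> ?thesis"
  hence "chord y c d u < chord y a b u" by simp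
  from chords_cross[OF less this] obtain s where
    s: "min t u < s" "s < max t u" "chord y a b s = chord y c d s" .
  have "(a, b) \<noteq> (c, d)" using less by auto
  moreover have "a < s" "s < b" "c < s" "s < d" using s t u by auto
  ultimately show False using edges_distinct_inside e s(3) by blast
qed

section \<open>Wedges and the charging of edges to vertices\<close>

text \<open>The edges from \<open>v\<close> to \<open>b\<close> (below) and to \<open>a\<close> (above) are consecutive among the edges going
  right from \<open>v\<close>, and no vertex of the wedge between them lies to the left of \<open>m\<close>.\<close>

definition wedge :: "real \<Rightarrow> real \<Rightarrow> real \<Rightarrow> real \<Rightarrow> bool" where
  "wedge v b a m \<longleftrightarrow> (v, b) \<in> F \<and> (v, a) \<in> F \<and> m \<in> S \<and> v < m \<and> m \<le> a \<and> m \<le> b \<and>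
     slope y v b < slope y v a \<and>
     (\<forall>c. (v, c) \<in> F \<longrightarrow> slope y v b < slope y v c \<longrightarrow>
        slope y v a \<le> slope y v c) \<and>
     (\<forall>s\<in>S. v < s \<longrightarrow> s < m \<longrightarrow> y s < chord y v b s \<or> chord y v a s < y s)"

text \<open>The last two assumptions say that the vertical sections of the two wedges over
  \<open>m\<close> overlap. If \<open>v < v'\<close>, then \<open>v'\<close> is a vertex to the left
  of \<open>m\<close> and so lies outside the first wedge. By persistence of the order, the second
  wedge stays on that side up to \<open>m\<close>, and the sections cannot overlap.\<close>

lemma wedge_apex_unique:
  assumes w: "wedge v b a m" "wedge v' b' a' m"
    and m: "chord y v b m < chord y v' a' m" "chord y v' b' m < chord y v a m"
  shows "\<not> v < v'"
proof
  assume "v < v'"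
  have W: "(v, b) \<in> F" "(v, a) \<in> F" "v < m" "m \<le> a" "m \<le> b"
    "(v', b') \<in> F" "(v', a') \<in> F" "v' < m" "m \<le> a'" "m \<le> b'"
    using w by (auto simp: wedge_def)
  have "v' \<in> S" using W edge_bounds by blast
  hence "y v' < chord y v b v' \<or> chord y v a v' < y v'"
    using w \<open>v < v'\<close> W by (auto simp: wedge_def)
  thus False
  proof
    assume "y v' < chord y v b v'"
    thus False
      using edge_order_persists[of v' a' v b v' m] W m \<open>v < v'\<close> by simp
  next
    assume "chord y v a v' < y v'"
    thus False
      using edge_order_persists[of v a v' b' v' m] W m \<open>v < v'\<close> by simp
  qed
qed

text \<open>No edge from \<open>v\<close> lies between \<open>b\<close> and \<open>a\<close>. A
  steeper lower edge \<open>b'\<close> is therefore at least as steep as \<open>a\<close>, and the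
  second wedge starts only where the first one has ended.\<close>

lemma wedge_lower_unique:
  assumes w: "wedge v b a m" "wedge v b' a' m"
    and m: "chord y v b' m < chord y v a m"
  shows "\<not> slope y v b < slope y v b'"
proof
  assume "slope y v b < slope y v b'"
  hence "slope y v a \<le> slope y v b'"
    using w by (auto simp: wedge_def)
  moreover have "v < m" using w by (simp add: wedge_def)
  ultimately show False
    using m by (simp add: chord_less_iff)
qed

text \<open>This is what makes the charging injective: distinct wedges with the same first vertex
  have sections over it that do not overlap.\<close>

lemma wedge_unique:
  assumes w: "wedge v b a m" "wedge v' b' a' m"
    and m: "chord y v b m < chord y v' a' m" "chord y v' b' m < chord y v a m"
  shows "(v, b) = (v', b')"
proof -
  have v: "v' = v"
    using wedge_apex_unique[OF w m] wedge_apex_unique[OF w(2,1) m(2,1)] by simp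
  have "slope y v b = slope y v b'"
    using wedge_lower_unique[of v b a m b' a'] wedge_lower_unique[of v b' a' m b a] w m v
    by fastforce
  moreover have "(v, b) \<in> F" "(v, b') \<in> F" using w v by (auto simp: wedge_def)
  ultimately have "b = b'" using fan_slope_inject by blast
  thus ?thesis using v by simp
qed

definition top_edges :: "(real \<times> real) set" where
  "top_edges = {(v, b) \<in> F. \<forall>c. (v, c) \<in> F \<longrightarrow> slope y v c \<le> slope y v b}"

lemma wedge_exists:
  assumes "(v, b) \<in> F - top_edges"
  obtains a m where "wedge v b a m"
    "chord y v b m \<le> y m" "y m \<le> chord y v a m" "chord y v b m < chord y v a m"
proof -
  define A where "A = {c. (v, c) \<in> F \<and> slope y v b < slope y v c}"
  have "A \<subseteq> S" using edge_bounds by (auto simp: A_def)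
  hence "finite A" using finite_S finite_subset by blast
  moreover have "A \<noteq> {}" using assms by (auto simp: A_def top_edges_def not_le)
  \<comment> \<open>The next edge above \<open>b\<close> among those going right from
    \<open>v\<close>.\<close>
  ultimately obtain a where a: "a \<in> A" "\<And>c. c \<in> A \<Longrightarrow> slope y v a \<le> slope y v c"
    using arg_min_if_finite[of A "\<lambda>c. slope y v c"] by (metis not_le)
  have va: "(v, a) \<in> F" and less: "slope y v b < slope y v a"
    using a by (auto simp: A_def)
  have vb: "(v, b) \<in> F" using assms by simp
  have bd: "v < a" "v < b" "a \<in> S" "b \<in> S" using va vb edge_bounds by auto
  have above: "chord y v b t < chord y v a t" if "v < t" for t
    using less that by (simp add: chord_less_iff)
  define M where "M = {s \<in> S. v < s \<and> s \<le> a \<and> s \<le> b \<and> chord y v b s \<le> y s \<and> y s \<le> chord y v a s}"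
  have "finite M" using finite_S by (simp add: M_def)
  \<comment> \<open>The nearer of the two right endpoints belongs to the closed wedge, so a first
    vertex exists.\<close>
  moreover have "min a b \<in> M"
    using bd above[of a] above[of b] by (auto simp: M_def min_def)
  ultimately have m: "Min M \<in> M" "\<And>s. s \<in> M \<Longrightarrow> Min M \<le> s"
    using Min_in by auto
  define m where "m = Min M"
  have mM: "m \<in> S" "v < m" "m \<le> a" "m \<le> b" "chord y v b m \<le> y m" "y m \<le> chord y v a m"
    using m(1) by (auto simp: M_def m_def)
  have "y s < chord y v b s \<or> chord y v a s < y s" if "s \<in> S" "v < s" "s < m" for s
  proof (rule ccontr)
    assume "\<not> ?thesis"
    hence "s \<in> M" using that mM by (auto simp: M_def)
    thus False using m(2) that by (fastforce simp: m_def)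
  qed
  hence "wedge v b a m"
    using va vb mM less a(2) by (auto simp: wedge_def A_def)
  thus thesis using that mM above by blast
qed

definition covered_above :: "real \<Rightarrow> bool" where
  "covered_above m \<longleftrightarrow> (\<exists>v a. (v, a) \<in> F \<and> v < m \<and> m < a \<and> y m < chord y v a m)"

definition covered_below :: "real \<Rightarrow> bool" where
  "covered_below m \<longleftrightarrow> (\<exists>v a. (v, a) \<in> F \<and> v < m \<and> m < a \<and> chord y v a m < y m)"

text \<open>\<open>(m, True)\<close> stands for the part of the wedge just above \<open>m\<close>, \<open>(m, False)\<close> for the part just
  below \<open>m\<close>.\<close>

fun charge :: "real \<times> real \<Rightarrow> real \<times> bool \<Rightarrow> bool" where
  "charge (v, b) (m, h) \<longleftrightarrow> (\<exists>a. wedge v b a m \<and>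
     (if h then chord y v b m \<le> y m \<and> y m < chord y v a m
      else chord y v b m < y m \<and> y m \<le> chord y v a m))"

lemma charge_exists:
  assumes "e \<in> F - top_edges"
  shows "\<exists>c. charge e c"
proof -
  obtain v b where e: "e = (v, b)" by (cases e)
  obtain a m where w: "wedge v b a m" "chord y v b m \<le> y m" "y m \<le> chord y v a m"
    "chord y v b m < chord y v a m"
    using wedge_exists assms e by blast
  \<comment> \<open>If \<open>m\<close> is off the upper edge, its upper side is charged. Otherwise
    \<open>m\<close> is strictly above the lower edge and its lower side is charged.\<close>
  hence "charge e (m, y m < chord y v a m)"
    by (auto simp: e)
  thus ?thesis ..
qed

text \<open>Two wedges charged to the same side of \<open>m\<close> both contain the points next to
  \<open>m\<close> on that side, so their sections over \<open>m\<close> overlap.\<close>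

lemma charge_unique:
  assumes "charge e c" "charge e' c"
  shows "e = e'"
proof -
  obtain v b v' b' m h where [simp]: "e = (v, b)" "e' = (v', b')" "c = (m, h)"
    by (cases e, cases e', cases c)
  obtain a a' where w: "wedge v b a m" "wedge v' b' a' m"
    and ch: "if h then chord y v b m \<le> y m \<and> y m < chord y v a m
      else chord y v b m < y m \<and> y m \<le> chord y v a m"
    "if h then chord y v' b' m \<le> y m \<and> y m < chord y v' a' m
      else chord y v' b' m < y m \<and> y m \<le> chord y v' a' m"
    using assms by auto
  have "chord y v b m < chord y v' a' m" "chord y v' b' m < chord y v a m"
    using ch by (auto split: if_splits)
  thus ?thesis using wedge_unique[OF w] by simp
qed

lemma charge_range:
  assumes "charge e c"
  shows "fst c \<in> S - {Min S, Max S}"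
    and "if snd c then covered_above (fst c) else covered_below (fst c)"
proof -
  obtain v b m h where [simp]: "e = (v, b)" "c = (m, h)"
    by (cases e, cases c)
  obtain a where w: "wedge v b a m"
    and ch: "if h then chord y v b m \<le> y m \<and> y m < chord y v a m
      else chord y v b m < y m \<and> y m \<le> chord y v a m"
    using assms by auto
  have F: "(v, b) \<in> F" "(v, a) \<in> F" "m \<in> S" "v < m" "m \<le> a" "m \<le> b"
    using w by (auto simp: wedge_def)
  have S: "v \<in> S" "a \<in> S" "b \<in> S" using F edge_bounds by auto
  \<comment> \<open>The strict inequality on the charged side shows that \<open>m\<close> is not the
    right endpoint of the edge on that side. This edge thus continues beyond \<open>m\<close>, so it
    covers \<open>m\<close>, and \<open>m\<close> is not the rightmost vertex.\<close>
  have up: "m < a" if h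
  proof -
    have "m \<noteq> a" using ch that F by auto
    thus ?thesis using F by simp
  qed
  have down: "m < b" if "\<not> h"
  proof -
    have "m \<noteq> b" using ch that F by auto
    thus ?thesis using F by simp
  qed
  have "Min S \<le> v" using S finite_S by simp
  moreover have "a \<le> Max S" "b \<le> Max S" using S finite_S by auto
  ultimately show "fst c \<in> S - {Min S, Max S}"
    using F up down by (cases h) auto
  show "if snd c then covered_above (fst c) else covered_below (fst c)"
  proof (cases h)
    case True
    hence "(v, a) \<in> F \<and> v < m \<and> m < a \<and> y m < chord y v a m" using F ch up by simp
    thus ?thesis using True unfolding covered_above_def by auto
  next
    case False
    hence "(v, b) \<in> F \<and> v < m \<and> m < b \<and> chord y v b m < y m" using F ch down by simp
    thus ?thesis using False unfolding covered_below_def by auto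
  qed
qed

section \<open>Counting the edges of one drawing\<close>

text \<open>Each vertex is the left endpoint of at most one topmost edge, and the rightmost vertex
  of none.\<close>

lemma card_top_edges:
  assumes "S \<noteq> {}"
  shows "card top_edges \<le> card S - 1"
proof -
  have inj: "inj_on fst top_edges"
  proof (rule inj_onI, clarsimp simp: top_edges_def)
    fix v b b' assume A: "(v, b) \<in> F" "(v, b') \<in> F"
      "\<forall>c. (v, c) \<in> F \<longrightarrow> slope y v c \<le> slope y v b"
      "\<forall>c. (v, c) \<in> F \<longrightarrow> slope y v c \<le> slope y v b'"
    hence "slope y v b = slope y v b'" by (meson order_antisym)
    thus "b = b'" using fan_slope_inject A by blast
  qed
  have "fst ` top_edges \<subseteq> S - {Max S}"
  proof
    fix v assume "v \<in> fst ` top_edges"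
    then obtain b where "(v, b) \<in> F" by (auto simp: top_edges_def)
    hence "v \<in> S" "b \<in> S" "v < b" using edge_bounds by auto
    moreover have "b \<le> Max S" using \<open>b \<in> S\<close> finite_S by simp
    ultimately show "v \<in> S - {Max S}" by auto
  qed
  hence "card (fst ` top_edges) \<le> card (S - {Max S})"
    using finite_S by (intro card_mono) auto
  also have "\<dots> = card S - 1" using assms finite_S by simp
  finally show ?thesis using inj by (simp add: card_image)
qed

text \<open>Suppose that the steepest edge from the leftmost vertex \<open>l\<close> ends at an
  inner vertex \<open>q\<close>. Let \<open>p\<close> be the leftmost inner vertex, up to
  \<open>q\<close>, on or above this edge. An edge passing over \<open>p\<close> cannot start at
  \<open>l\<close>, where it would be steeper; elsewhere its left endpoint would also be on or above
  the edge \<open>l q\<close>, but to the left of \<open>p\<close>.\<close>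

lemma all_covered_above_imp_long_edge:
  assumes n: "card S \<ge> 3"
    and cov: "\<And>m. m \<in> S - {Min S, Max S} \<Longrightarrow> covered_above m"
  shows "(Min S, Max S) \<in> F"
proof (rule ccontr)
  assume no: "(Min S, Max S) \<notin> F"
  define l where "l = Min S"
  have ne: "S \<noteq> {}" using n by auto
  have l: "l \<in> S" "\<And>s. s \<in> S \<Longrightarrow> l \<le> s" using ne finite_S by (auto simp: l_def)
  define I where "I = S - {Min S, Max S}"
  have finI: "finite I" using finite_S by (simp add: I_def)
  have "I \<noteq> {}"
  proof
    assume "I = {}"
    hence "S \<subseteq> {Min S, Max S}" by (auto simp: I_def)
    hence "card S \<le> card {Min S, Max S}" by (intro card_mono) auto
    also have "\<dots> \<le> 2" by (simp add: card_insert_if)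
    finally show False using n by simp
  qed
  have left: "v = l \<or> v \<in> I" if "(v, a) \<in> F" for v a
  proof -
    have "v \<in> S" "a \<in> S" "v < a" using edge_bounds that by auto
    moreover have "a \<le> Max S" using \<open>a \<in> S\<close> finite_S by simp
    ultimately show ?thesis by (auto simp: I_def l_def)
  qed
  define Q where "Q = {q. (l, q) \<in> F}"
  have "Q \<subseteq> S" using edge_bounds by (auto simp: Q_def)
  hence "finite Q" using finite_S finite_subset by blast
  moreover have "Q \<noteq> {}"
  proof -
    \<comment> \<open>Only \<open>l\<close> is to the left of the first inner vertex, so an edge
      covering that vertex starts at \<open>l\<close>.\<close>
    have "Min I \<in> I" using finI \<open>I \<noteq> {}\<close> by simp
    hence "covered_above (Min I)" using cov by (simp add: I_def)
    then obtain v a where va: "(v, a) \<in> F" "v < Min I" by (auto simp: covered_above_def)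
    hence "v \<notin> I" using finI by (meson Min_le leD)
    thus ?thesis using left va by (auto simp: Q_def)
  qed
  ultimately obtain q where q: "q \<in> Q" "\<And>c. c \<in> Q \<Longrightarrow> slope y l c \<le> slope y l q"
    using arg_min_if_finite[of Q "\<lambda>c. - slope y l c"] by (metis neg_less_iff_less not_le)
  have lq: "(l, q) \<in> F" "l < q" "q \<in> S" using q edge_bounds by (auto simp: Q_def)
  define U where "U = {p \<in> I. p \<le> q \<and> chord y l q p \<le> y p}"
  have "q \<in> U" using lq no by (auto simp: U_def I_def l_def)
  moreover have "finite U" using finI by (simp add: U_def)
  ultimately have p: "Min U \<in> U" "\<And>s. s \<in> U \<Longrightarrow> Min U \<le> s"
    using Min_in by auto
  define p where "p = Min U"
  have pI: "p \<in> I" "p \<le> q" "chord y l q p \<le> y p" using p by (auto simp: U_def p_def)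
  obtain v a where va: "(v, a) \<in> F" "v < p" "p < a" "y p < chord y v a p"
    using cov[of p] pI(1) by (auto simp: covered_above_def I_def)
  have lp: "l < p" using pI l by (auto simp: I_def l_def less_le)
  show False
  proof (cases "v = l")
    case True
    have "chord y l q p < chord y l a p" using pI va True by simp
    hence "slope y l q < slope y l a"
      using lp by (simp add: chord_less_iff)
    thus False using q(2)[of a] va True by (auto simp: Q_def)
  next
    case False
    hence vI: "v \<in> I" using left va by blast
    hence "l \<le> v" using l by (simp add: I_def)
    have "chord y l q v \<le> chord y v a v"
      using edge_order_persists[of l q v a p v] lq va pI lp \<open>l \<le> v\<close> by simp
    hence "v \<in> U" using vI va pI by (simp add: U_def)
    thus False using p(2)[of v] va by (simp add: p_def)
  qed
qed

text \<open>Reflection in the horizontal axis exchanges above and below.\<close>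

lemma all_covered_below_imp_long_edge:
  assumes n: "card S \<ge> 3"
    and cov: "\<And>m. m \<in> S - {Min S, Max S} \<Longrightarrow> covered_below m"
  shows "(Min S, Max S) \<in> F"
proof -
  interpret r: plane_drawing S F "\<lambda>s. - y s" by (rule reflect)
  have "r.covered_above = covered_below"
    by (simp add: fun_eq_iff r.covered_above_def covered_below_def chord_uminus)
  thus ?thesis using r.all_covered_above_imp_long_edge[OF n] cov by metis
qed

lemma card_edges_without_long_edge:
  assumes n: "card S \<ge> 3" and no: "(Min S, Max S) \<notin> F"
  shows "card F + 7 \<le> 3 * card S"
proof -
  define I where "I = S - {Min S, Max S}"
  have ne: "S \<noteq> {}" using n by auto
  have "Min S \<noteq> Max S"
  proof
    assume "Min S = Max S"
    hence "S \<subseteq> {Min S}" using finite_S by (metis Max_ge Min_le antisym insertCI subsetI)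
    hence "card S \<le> card {Min S}" by (intro card_mono) auto
    thus False using n by simp
  qed
  hence cI: "card I = card S - 2"
    using ne finite_S by (simp add: I_def card_Diff_subset)
  obtain p where p: "p \<in> I" "\<not> covered_above p"
    using all_covered_above_imp_long_edge[OF n] no unfolding I_def by blast
  obtain q where q: "q \<in> I" "\<not> covered_below q"
    using all_covered_below_imp_long_edge[OF n] no unfolding I_def by blast
  \<comment> \<open>The upper side of \<open>p\<close> and the lower side of \<open>q\<close> are
    never charged. These are two distinct pairs even if \<open>p = q\<close>.\<close>
  define T where "T = I \<times> (UNIV :: bool set) - {(p, True), (q, False)}"
  have fI: "finite I" using finite_S by (simp add: I_def)
  have cT: "card T = 2 * (card S - 2) - 2"
    using p q fI by (simp add: T_def card_Diff_subset card_cartesian_product cI)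
  have "\<forall>e \<in> F - top_edges. \<exists>c. charge e c" using charge_exists by blast
  then obtain f where f: "\<And>e. e \<in> F - top_edges \<Longrightarrow> charge e (f e)" by metis
  have "inj_on f (F - top_edges)"
    using f charge_unique by (metis inj_onI)
  moreover have "f ` (F - top_edges) \<subseteq> T"
  proof
    fix c assume "c \<in> f ` (F - top_edges)"
    then obtain e where "charge e c" using f by blast
    thus "c \<in> T"
      using charge_range[of e c] p q by (cases c) (auto simp: T_def I_def split: if_splits)
  qed
  moreover have "finite T" using fI by (simp add: T_def)
  ultimately have "card (F - top_edges) \<le> 2 * (card S - 2) - 2"
    using card_inj_on_le cT by metis
  moreover have "card F = card (F - top_edges) + card top_edges"
  proof -
    have "top_edges \<subseteq> F" by (auto simp: top_edges_def)
    thus ?thesis using finite_F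
      by (metis card_Diff_subset card_mono finite_subset le_add_diff_inverse2)
  qed
  ultimately show ?thesis using card_top_edges[OF ne] n by linarith
qed

section \<open>Adding edges at both ends and combining two drawings\<close>

text \<open>Every edge not containing \<open>a\<close> or \<open>b\<close> lies entirely to the right of the new segment.\<close>

lemma insert_edge_left:
  assumes ab: "a \<in> S" "b \<in> S" "a < b"
    and side: "\<And>s. s \<in> S \<Longrightarrow> s \<noteq> a \<Longrightarrow> s \<noteq> b \<Longrightarrow> b < s"
  shows "plane_drawing S (insert (a, b) F) y"
proof
  fix c d e assume *: "(c, d) \<in> insert (a, b) F" "e \<in> S" "c < e" "e < d"
  have "(c, d) \<in> F" using * ab side[of e] by force
  thus "chord y c d e \<noteq> y e" using * vertex_off_edge by blast
next
  fix c d c' d' t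
  assume *: "(c, d) \<in> insert (a, b) F" "(c', d') \<in> insert (a, b) F" "{c, d} \<inter> {c', d'} = {}"
    "c \<le> t" "t \<le> d" "c' \<le> t" "t \<le> d'"
  have "(c, d) \<in> F"
  proof (rule ccontr)
    assume "(c, d) \<notin> F"
    hence cd: "c = a" "d = b" using * by auto
    hence "(c', d') \<in> F" "c' \<noteq> a" "c' \<noteq> b" using * by auto
    thus False using side[of c'] edge_bounds[of c' d'] * cd by force
  qed
  moreover have "(c', d') \<in> F"
  proof (rule ccontr)
    assume "(c', d') \<notin> F"
    hence cd: "c' = a" "d' = b" using * by auto
    hence "(c, d) \<in> F" "c \<noteq> a" "c \<noteq> b" using * by auto
    thus False using side[of c] edge_bounds[of c d] * cd by force
  qed
  ultimately show "chord y c d t \<noteq> chord y c' d' t"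
    using * disjoint_edges[of c d c' d' t] by blast
qed (use finite_S edge_bounds ab in auto)

text \<open>Mirror image of the insertion at the left end: an edge avoiding \<open>a\<close> and
  \<open>b\<close> has its right endpoint, hence all its points, to the left of the new
  segment.\<close>

lemma insert_edge_right:
  assumes ab: "a \<in> S" "b \<in> S" "a < b"
    and side: "\<And>s. s \<in> S \<Longrightarrow> s \<noteq> a \<Longrightarrow> s \<noteq> b \<Longrightarrow> s < a"
  shows "plane_drawing S (insert (a, b) F) y"
proof
  fix c d e assume *: "(c, d) \<in> insert (a, b) F" "e \<in> S" "c < e" "e < d"
  have "(c, d) \<in> F" using * ab side[of e] by force
  thus "chord y c d e \<noteq> y e" using * vertex_off_edge by blast
next
  fix c d c' d' t
  assume *: "(c, d) \<in> insert (a, b) F" "(c', d') \<in> insert (a, b) F" "{c, d} \<inter> {c', d'} = {}"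
    "c \<le> t" "t \<le> d" "c' \<le> t" "t \<le> d'"
  have "(c, d) \<in> F"
  proof (rule ccontr)
    assume "(c, d) \<notin> F"
    hence cd: "c = a" "d = b" using * by auto
    hence "(c', d') \<in> F" "d' \<noteq> a" "d' \<noteq> b" using * by auto
    thus False using side[of d'] edge_bounds[of c' d'] * cd by force
  qed
  moreover have "(c', d') \<in> F"
  proof (rule ccontr)
    assume "(c', d') \<notin> F"
    hence cd: "c' = a" "d' = b" using * by auto
    hence "(c, d) \<in> F" "d \<noteq> a" "d \<noteq> b" using * by auto
    thus False using side[of d] edge_bounds[of c d] * cd by force
  qed
  ultimately show "chord y c d t \<noteq> chord y c' d' t"
    using * disjoint_edges[of c d c' d' t] by blast
qed (use finite_S edge_bounds ab in auto)

end

text \<open>Since \<open>S\<close> is common to both drawings, so are the extreme vertices, and the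
  same two edges can be added to either drawing, whatever the heights are.\<close>

lemma card_union_of_two_drawings:
  assumes d1: "plane_drawing S F1 y" and d2: "plane_drawing S F2 z"
    and n: "card S \<ge> 4"
  shows "card (F1 \<union> F2) + 15 \<le> 6 * card S"
proof -
  have fin: "finite S" using d1 by (rule plane_drawing.finite_S)
  have ne: "S \<noteq> {}" using n by auto
  define l r where "l = Min S" and "r = Max S"
  have lr: "l \<in> S" "r \<in> S" "\<And>s. s \<in> S \<Longrightarrow> l \<le> s \<and> s \<le> r"
    using fin ne by (auto simp: l_def r_def)
  define I where "I = S - {l, r}"
  have fI: "finite I" using fin by (simp add: I_def)
  have "card S \<le> card I + 2"
  proof -
    have "card S \<le> card (I \<union> {l, r})" using fI by (intro card_mono) (auto simp: I_def)
    also have "\<dots> \<le> card I + card {l, r}" by (rule card_Un_le)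
    also have "card {l, r} \<le> 2" by (simp add: card_insert_if)
    finally show ?thesis by simp
  qed
  hence cI: "card I \<ge> 2" using n by simp
  hence neI: "I \<noteq> {}" by auto
  define p q where "p = Min I" and "q = Max I"
  have pq: "p \<in> I" "q \<in> I" "\<And>s. s \<in> I \<Longrightarrow> p \<le> s \<and> s \<le> q"
    using fI neI by (auto simp: p_def q_def)
  have "p \<noteq> q"
  proof
    assume "p = q"
    hence "I \<subseteq> {p}" using pq(3) by force
    hence "card I \<le> card {p}" by (intro card_mono) auto
    thus False using cI by simp
  qed
  hence "p < q" using pq by force
  have lp: "l < p" "p \<in> S" "q < r" "q \<in> S"
    using pq lr by (auto simp: I_def less_le)
  have sideL: "p < s" if "s \<in> S" "s \<noteq> l" "s \<noteq> p" for s
    using that pq(3)[of s] \<open>p < q\<close> lp by (cases "s = r") (auto simp: I_def)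
  have sideR: "s < q" if "s \<in> S" "s \<noteq> q" "s \<noteq> r" for s
    using that pq(3)[of s] \<open>p < q\<close> lp by (cases "s = l") (auto simp: I_def)
  define G where "G = {(l, p), (q, r)}"
  have cG: "card G = 2" using \<open>p < q\<close> lp by (auto simp: G_def)
  have bound: "card ((F - {(l, r)}) \<union> G) + 7 \<le> 3 * card S \<and> finite F"
    if "plane_drawing S F h" for F h
  proof -
    interpret plane_drawing S F h by fact
    interpret i1: plane_drawing S "F - {(l, r)}" h by (rule subset) auto
    interpret i2: plane_drawing S "insert (l, p) (F - {(l, r)})" h
      using i1.insert_edge_left lr lp sideL by blast
    interpret i3: plane_drawing S "insert (q, r) (insert (l, p) (F - {(l, r)}))" h
      using i2.insert_edge_right lr lp sideR by blast
    have "(Min S, Max S) \<notin> insert (q, r) (insert (l, p) (F - {(l, r)}))"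
      using lp \<open>p < q\<close> by (auto simp: l_def[symmetric] r_def[symmetric])
    moreover have "insert (q, r) (insert (l, p) (F - {(l, r)})) = (F - {(l, r)}) \<union> G"
      by (auto simp: G_def)
    ultimately show ?thesis
      using i3.card_edges_without_long_edge n finite_F by auto
  qed
  define A B where "A = (F1 - {(l, r)}) \<union> G" and "B = (F2 - {(l, r)}) \<union> G"
  have AB: "card A + 7 \<le> 3 * card S" "card B + 7 \<le> 3 * card S" "finite A" "finite B"
    using bound[OF d1] bound[OF d2] by (auto simp: A_def B_def G_def)
  \<comment> \<open>\<open>A\<close> and \<open>B\<close> share the two edges of \<open>G\<close>,
    so their union has at most \<open>2 (3 n - 7) - 2\<close> elements for
    \<open>n = card S\<close>. The edge \<open>(l, r)\<close>, removed from both, adds at most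
    one.\<close>
  have "card A + card B = card (A \<union> B) + card (A \<inter> B)"
    using AB card_Un_Int by blast
  moreover have "card G \<le> card (A \<inter> B)"
    using AB by (intro card_mono) (auto simp: A_def B_def)
  moreover have "card (F1 \<union> F2) \<le> card (insert (l, r) (A \<union> B))"
    using AB by (intro card_mono) (auto simp: A_def B_def)
  moreover have "card (insert (l, r) (A \<union> B)) \<le> Suc (card (A \<union> B))"
    by (rule card_insert_le_m1[THEN order_trans]) (auto simp: card_insert_if AB)
  ultimately show ?thesis using AB cG by linarith
qed


section \<open>Stability under small perturbations\<close>

text \<open>A hyperplane strictly separates the two limit hulls. The finitely many strict
  inequalities at the generating points persist near the limit, and open half-spaces, being convex,
  then contain the perturbed hulls.\<close>

lemma eventually_disjoint_hulls:
  fixes f :: "'t \<Rightarrow> 'v \<Rightarrow> 'e :: euclidean_space"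
  assumes fin: "finite A" "finite B"
    and disj: "convex hull (g ` A) \<inter> convex hull (g ` B) = {}"
    and lim: "\<And>v. v \<in> A \<union> B \<Longrightarrow> ((\<lambda>t. f t v) \<longlongrightarrow> g v) T"
  shows "\<forall>\<^sub>F t in T. convex hull (f t ` A) \<inter> convex hull (f t ` B) = {}"
proof (cases "B = {}")
  case False
  have "\<exists>n c. (\<forall>x\<in>convex hull (g ` A). n \<bullet> x < c) \<and> (\<forall>x\<in>convex hull (g ` B). n \<bullet> x > c)"
    by (rule separating_hyperplane_closed_compact)
      (use fin False disj in \<open>simp_all add: finite_imp_compact_convex_hull compact_imp_closed\<close>)
  then obtain n c where sepA: "\<forall>x\<in>convex hull (g ` A). n \<bullet> x < c"
    and sepB: "\<forall>x\<in>convex hull (g ` B). c < n \<bullet> x" by blast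
  have "\<forall>\<^sub>F t in T. n \<bullet> f t v < c" if "v \<in> A" for v
  proof (rule order_tendstoD(2))
    show "((\<lambda>t. n \<bullet> f t v) \<longlongrightarrow> n \<bullet> g v) T" using that by (intro tendsto_intros lim) simp
    show "n \<bullet> g v < c" using sepA that by (simp add: hull_inc)
  qed
  hence evA: "\<forall>\<^sub>F t in T. \<forall>v\<in>A. n \<bullet> f t v < c"
    using fin by (simp add: eventually_ball_finite)
  have "\<forall>\<^sub>F t in T. c < n \<bullet> f t v" if "v \<in> B" for v
  proof (rule order_tendstoD(1))
    show "((\<lambda>t. n \<bullet> f t v) \<longlongrightarrow> n \<bullet> g v) T" using that by (intro tendsto_intros lim) simp
    show "c < n \<bullet> g v" using sepB that by (simp add: hull_inc)
  qed
  hence evB: "\<forall>\<^sub>F t in T. \<forall>v\<in>B. c < n \<bullet> f t v"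
    using fin by (simp add: eventually_ball_finite)
  from evA evB show ?thesis
  proof eventually_elim
    case (elim t)
    have "convex hull (f t ` A) \<subseteq> {x. n \<bullet> x < c}"
      using elim(1) by (intro hull_minimal) (auto simp: convex_halfspace_lt)
    moreover have "convex hull (f t ` B) \<subseteq> {x. n \<bullet> x > c}"
      using elim(2) by (intro hull_minimal) (auto simp: convex_halfspace_gt)
    ultimately show ?case by fastforce
  qed
qed simp

text \<open>Unlike \<open>straight_line_embedding\<close>, this only asks that certain compact convex sets be disjoint,
  hence it survives small perturbations of \<open>f\<close>.\<close>

definition crossing_free :: "'a set \<Rightarrow> 'a set set \<Rightarrow> ('a \<Rightarrow> real \<times> real) \<Rightarrow> bool" where
  "crossing_free V E f \<longleftrightarrow>
     (\<forall>e\<in>E. \<forall>v\<in>V. v \<notin> e \<longrightarrow> convex hull (f ` e) \<inter> convex hull (f ` {v}) = {}) \<and>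
     (\<forall>e\<in>E. \<forall>e'\<in>E. e \<inter> e' = {} \<longrightarrow> convex hull (f ` e) \<inter> convex hull (f ` e') = {})"

lemma straight_line_embedding_imp_crossing_free:
  assumes "straight_line_embedding V E f" "simple_graph V E"
  shows "crossing_free V E f"
proof -
  have "e \<noteq> e'" if "e \<in> E" "e \<inter> e' = {}" for e e'
  proof
    assume "e = e'"
    hence "card e = 0" using that by simp
    thus False using assms(2) that by (auto simp: simple_graph_def)
  qed
  hence "convex hull (f ` e) \<inter> convex hull (f ` e') = {}"
    if "e \<in> E" "e' \<in> E" "e \<inter> e' = {}" for e e'
    using assms(1) that unfolding straight_line_embedding_def edge_segment_def
    by (metis image_empty)
  moreover have "f v \<notin> convex hull (f ` e)" if "e \<in> E" "v \<in> V" "v \<notin> e" for e v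
    using assms(1) that unfolding straight_line_embedding_def edge_segment_def by blast
  ultimately show ?thesis by (simp add: crossing_free_def)
qed

text \<open>Used to bring the coordinate shared by the two planes to the first place. Swapping is
  linear and injective, so it commutes with convex hulls and preserves disjointness.\<close>

lemma crossing_free_swap:
  assumes "crossing_free V E f"
  shows "crossing_free V E (\<lambda>v. prod.swap (f v))"
proof -
  have "linear (prod.swap :: real \<times> real \<Rightarrow> real \<times> real)"
    by (rule linearI) (simp_all add: prod_eq_iff)
  hence hull: "convex hull ((\<lambda>v. prod.swap (f v)) ` e) = prod.swap ` (convex hull (f ` e))" for e
    using convex_hull_linear_image[of prod.swap "f ` e"] by (simp add: image_image)
  have disj: "convex hull ((\<lambda>v. prod.swap (f v)) ` A) \<inter> convex hull ((\<lambda>v. prod.swap (f v)) ` B) = {}"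
    if "convex hull (f ` A) \<inter> convex hull (f ` B) = {}" for A B
    unfolding hull image_Int[OF inj_swap, symmetric] that by simp
  show ?thesis unfolding crossing_free_def
    by (intro conjI ballI impI disj) (use assms in \<open>simp_all add: crossing_free_def\<close>)
qed

lemma eventually_crossing_free:
  assumes "simple_graph V E" "crossing_free V E g"
    and lim: "\<And>v. v \<in> V \<Longrightarrow> ((\<lambda>t. f t v) \<longlongrightarrow> g v) T"
  shows "\<forall>\<^sub>F t in T. crossing_free V E (f t)"
proof -
  have sub: "e \<subseteq> V" if "e \<in> E" for e
    using assms(1) that by (simp add: simple_graph_def)
  have finV: "finite V" using assms(1) by (simp add: simple_graph_def)
  have "E \<subseteq> Pow V" using sub by blast
  hence finE: "finite E" using finV finite_subset by blast
  have fine: "finite e" if "e \<in> E" for e using sub[OF that] finV finite_subset by blast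
  have 1: "\<forall>\<^sub>F t in T. \<forall>e\<in>E. \<forall>v\<in>V. v \<notin> e \<longrightarrow> convex hull (f t ` e) \<inter> convex hull (f t ` {v}) = {}"
  proof (intro eventually_ball_finite finE finV ballI)
    fix e v assume ev: "e \<in> E" "v \<in> V"
    show "\<forall>\<^sub>F t in T. v \<notin> e \<longrightarrow> convex hull (f t ` e) \<inter> convex hull (f t ` {v}) = {}"
    proof (cases "v \<in> e")
      case False
      have "\<forall>\<^sub>F t in T. convex hull (f t ` e) \<inter> convex hull (f t ` {v}) = {}"
      proof (rule eventually_disjoint_hulls)
        show "convex hull (g ` e) \<inter> convex hull (g ` {v}) = {}"
          using assms(2) ev False by (simp add: crossing_free_def)
      qed (use fine sub ev lim in auto)
      thus ?thesis by (rule eventually_mono) simp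
    qed simp
  qed
  have 2: "\<forall>\<^sub>F t in T. \<forall>e\<in>E. \<forall>e'\<in>E. e \<inter> e' = {} \<longrightarrow> convex hull (f t ` e) \<inter> convex hull (f t ` e') = {}"
  proof (intro eventually_ball_finite finE ballI)
    fix e e' assume ev: "e \<in> E" "e' \<in> E"
    show "\<forall>\<^sub>F t in T. e \<inter> e' = {} \<longrightarrow> convex hull (f t ` e) \<inter> convex hull (f t ` e') = {}"
    proof (cases "e \<inter> e' = {}")
      case True
      have "\<forall>\<^sub>F t in T. convex hull (f t ` e) \<inter> convex hull (f t ` e') = {}"
      proof (rule eventually_disjoint_hulls)
        show "convex hull (g ` e) \<inter> convex hull (g ` e') = {}"
          using assms(2) ev True by (simp add: crossing_free_def)
      qed (use fine sub ev lim in auto)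
      thus ?thesis by (rule eventually_mono) simp
    qed simp
  qed
  from 1 2 show ?thesis
    unfolding crossing_free_def by (rule eventually_conj)
qed

text \<open>Vertices with equal \<open>x\<close> are separated by every \<open>t > 0\<close>, since
  \<open>i\<close> is injective; those with different \<open>x\<close> stay apart for small
  \<open>t\<close>.\<close>

lemma eventually_inj_on_perturbation:
  fixes x i :: "'a \<Rightarrow> real"
  assumes "finite V" "inj_on i V"
  shows "\<forall>\<^sub>F t in at_right 0. inj_on (\<lambda>v. x v + t * i v) V"
proof -
  have "\<forall>\<^sub>F t in at_right 0. u \<noteq> v \<longrightarrow> x u + t * i u \<noteq> x v + t * i v"
    if uv: "u \<in> V" "v \<in> V" for u v
  proof (cases "x u = x v")
    case True
    have "\<forall>\<^sub>F t in at_right (0 :: real). t > 0" by (rule eventually_at_right_less)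
    thus ?thesis
      by (rule eventually_mono) (use True assms(2) uv in \<open>auto dest: inj_onD\<close>)
  next
    case False
    have "((\<lambda>t. (x u + t * i u) - (x v + t * i v)) \<longlongrightarrow> (x u + 0 * i u) - (x v + 0 * i v)) (at_right 0)"
      by (intro tendsto_intros)
    hence "\<forall>\<^sub>F t in at_right 0. (x u + t * i u) - (x v + t * i v) \<noteq> 0"
      by (rule tendsto_imp_eventually_ne) (use False in simp)
    thus ?thesis by (rule eventually_mono) simp
  qed
  hence "\<forall>\<^sub>F t in at_right 0. \<forall>u\<in>V. \<forall>v\<in>V. u \<noteq> v \<longrightarrow> x u + t * i u \<noteq> x v + t * i v"
    using assms(1) by (intro eventually_ball_finite ballI) auto
  thus ?thesis by (rule eventually_mono) (auto simp: inj_on_def)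
qed

section \<open>From embeddings to drawings over a set of reals\<close>

text \<open>Over its range, a chord runs inside the hull of the edge it represents, so equal heights
  over one abscissa would give a common point of two disjoint hulls.\<close>

lemma crossing_free_imp_plane_drawing:
  fixes x y :: "'a \<Rightarrow> real"
  assumes fin: "finite V" and cf: "crossing_free V E (\<lambda>v. (x v, y v))"
  defines "g \<equiv> inv_into V x"
  shows "plane_drawing (x ` V) {(a, b) \<in> x ` V \<times> x ` V. a < b \<and> {g a, g b} \<in> E} (y \<circ> g)"
    (is "plane_drawing _ ?F _")
proof
  define f where "f v = (x v, y v)" for v
  have gV: "g a \<in> V" "x (g a) = a" if "a \<in> x ` V" for a
    using that by (simp_all add: g_def inv_into_into f_inv_into_f)
  have cf': "crossing_free V E f" using cf by (simp add: f_def[abs_def])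
  have mem: "(t, chord (y \<circ> g) a b t) \<in> convex hull (f ` {g a, g b})"
    if "a \<in> x ` V" "b \<in> x ` V" "a < b" "a \<le> t" "t \<le> b" for a b t
    using chord_mem_segment[of a b t "y \<circ> g"] that gV by (simp add: segment_convex_hull f_def)
  {
    fix a b c
    assume ab: "(a, b) \<in> ?F" and c: "c \<in> x ` V" "a < c" "c < b"
    have ab': "a \<in> x ` V" "b \<in> x ` V" "a < b" "{g a, g b} \<in> E" using ab by auto
    have "g c \<noteq> g a" "g c \<noteq> g b" using gV ab' c by (metis less_irrefl)+
    hence "g c \<notin> {g a, g b}" by simp
    hence "convex hull (f ` {g a, g b}) \<inter> convex hull (f ` {g c}) = {}"
      using ab'(4) gV(1)[OF c(1)] cf' unfolding crossing_free_def by metis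
    moreover have "(c, (y \<circ> g) c) \<in> convex hull (f ` {g c})"
      using c gV by (simp add: f_def)
    ultimately show "chord (y \<circ> g) a b c \<noteq> (y \<circ> g) c"
      using mem[of a b c] ab' c by (metis IntI empty_iff less_imp_le)
  }
  {
    fix a b c d t
    assume ab: "(a, b) \<in> ?F" and cd: "(c, d) \<in> ?F" and disj: "{a, b} \<inter> {c, d} = {}"
      and t: "a \<le> t" "t \<le> b" "c \<le> t" "t \<le> d"
    have ab': "a \<in> x ` V" "b \<in> x ` V" "a < b" "{g a, g b} \<in> E" using ab by auto
    have cd': "c \<in> x ` V" "d \<in> x ` V" "c < d" "{g c, g d} \<in> E" using cd by auto
    have "g a \<noteq> g c" "g a \<noteq> g d" "g b \<noteq> g c" "g b \<noteq> g d"
      using gV ab' cd' disj by (metis IntI empty_iff insertCI)+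
    hence "{g a, g b} \<inter> {g c, g d} = {}" by auto
    hence "convex hull (f ` {g a, g b}) \<inter> convex hull (f ` {g c, g d}) = {}"
      using ab'(4) cd'(4) cf' unfolding crossing_free_def by metis
    thus "chord (y \<circ> g) a b t \<noteq> chord (y \<circ> g) c d t"
      using mem[of a b t] mem[of c d t] ab' cd' t by (metis IntI empty_iff)
  }
qed (use fin in auto)

lemma card_union_of_two_crossing_free:
  fixes x y z :: "'a \<Rightarrow> real"
  assumes g: "simple_graph V (E1 \<union> E2)" and n: "card V \<ge> 3"
    and e1: "crossing_free V E1 (\<lambda>v. (x v, y v))" and e2: "crossing_free V E2 (\<lambda>v. (x v, z v))"
  shows "card (E1 \<union> E2) \<le> 6 * card V - 15"
proof (cases "card V = 3")
  \<comment> \<open>Here the bound is \<open>6 * 3 - 15 = 3\<close>, the number of all pairs of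
    vertices.\<close>
  case True
  have "E1 \<union> E2 \<subseteq> {e. e \<subseteq> V \<and> card e = 2}" using g by (auto simp: simple_graph_def)
  moreover have "finite {e. e \<subseteq> V \<and> card e = 2}" using g by (simp add: simple_graph_def)
  ultimately have "card (E1 \<union> E2) \<le> card {e. e \<subseteq> V \<and> card e = 2}" by (intro card_mono)
  also have "\<dots> = 3 choose 2" using n_subsets[of V 2] g True by (simp add: simple_graph_def)
  also have "\<dots> = 3" by (simp add: numeral_eq_Suc)
  finally show ?thesis using True by simp
next
  case False
  hence n4: "card V \<ge> 4" using n by simp
  have fin: "finite V" and s1: "simple_graph V E1" and s2: "simple_graph V E2"
    using g by (auto simp: simple_graph_def)
  obtain i0 :: "'a \<Rightarrow> nat" where "inj_on i0 V" using fin finite_imp_inj_to_nat_seg by metis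
  then have inj: "inj_on (\<lambda>v. real (i0 v)) V" by (auto simp: inj_on_def)
  \<comment> \<open>Only the shared coordinate is perturbed, and identically in both drawings, so
    they keep a common set of abscissas.\<close>
  define X where "X t v = x v + t * real (i0 v)" for t v
  have Xlim: "((\<lambda>t. X t v) \<longlongrightarrow> x v) (at_right 0)" for v
  proof -
    have "((\<lambda>t. X t v) \<longlongrightarrow> x v + 0 * real (i0 v)) (at_right 0)"
      unfolding X_def by (intro tendsto_intros)
    thus ?thesis by simp
  qed
  have "\<forall>\<^sub>F t in at_right 0. inj_on (X t) V"
    using eventually_inj_on_perturbation[OF fin inj] by (simp add: X_def[abs_def])
  moreover have "\<forall>\<^sub>F t in at_right 0. crossing_free V E1 (\<lambda>v. (X t v, y v))"
    by (rule eventually_crossing_free[OF s1 e1]) (intro tendsto_intros Xlim)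
  moreover have "\<forall>\<^sub>F t in at_right 0. crossing_free V E2 (\<lambda>v. (X t v, z v))"
    by (rule eventually_crossing_free[OF s2 e2]) (intro tendsto_intros Xlim)
  ultimately have "\<forall>\<^sub>F t in at_right (0::real). inj_on (X t) V \<and>
      crossing_free V E1 (\<lambda>v. (X t v, y v)) \<and> crossing_free V E2 (\<lambda>v. (X t v, z v))"
    by (intro eventually_conj)
  then obtain t where injX: "inj_on (X t) V"
    and c1: "crossing_free V E1 (\<lambda>v. (X t v, y v))" and c2: "crossing_free V E2 (\<lambda>v. (X t v, z v))"
    using eventually_happens'[OF trivial_limit_at_right_real] by blast
  define h where "h = inv_into V (X t)"
  define pairs where "pairs E = {(a, b) \<in> X t ` V \<times> X t ` V. a < b \<and> {h a, h b} \<in> E}" for E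
  have d: "plane_drawing (X t ` V) (pairs E1) (y \<circ> h)" "plane_drawing (X t ` V) (pairs E2) (z \<circ> h)"
    using crossing_free_imp_plane_drawing[OF fin c1]
      crossing_free_imp_plane_drawing[OF fin c2] by (simp_all add: pairs_def h_def)
  have "card (pairs E1 \<union> pairs E2) + 15 \<le> 6 * card V"
    using card_union_of_two_drawings[OF d] n4 by (simp add: card_image injX)
  moreover have "card (E1 \<union> E2) \<le> card (pairs E1 \<union> pairs E2)"
  proof (rule surj_card_le)
    show "finite (pairs E1 \<union> pairs E2)"
      using d by (simp add: plane_drawing.finite_F)
    \<comment> \<open>Each edge comes from the pair of the perturbed abscissas of its endpoints, in
      increasing order.\<close>
    show "E1 \<union> E2 \<subseteq> (\<lambda>(a, b). {h a, h b}) ` (pairs E1 \<union> pairs E2)"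
    proof
      fix e assume e: "e \<in> E1 \<union> E2"
      hence "e \<subseteq> V" "card e = 2" using g by (auto simp: simple_graph_def)
      then obtain u v where uv: "e = {u, v}" "u \<noteq> v" "u \<in> V" "v \<in> V"
        by (auto simp: card_2_iff)
      have hX: "h (X t u) = u" "h (X t v) = v" using injX uv by (simp_all add: h_def)
      have "X t u \<noteq> X t v" using injX uv by (auto dest: inj_onD)
      then consider "X t u < X t v" | "X t v < X t u" by linarith
      thus "e \<in> (\<lambda>(a, b). {h a, h b}) ` (pairs E1 \<union> pairs E2)"
      proof cases
        case 1
        hence "(X t u, X t v) \<in> pairs E1 \<union> pairs E2" using e uv hX by (auto simp: pairs_def)
        thus ?thesis using uv hX by force
      next
        case 2
        hence "(X t v, X t u) \<in> pairs E1 \<union> pairs E2"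
          using e uv hX by (auto simp: pairs_def insert_commute)
        thus ?thesis using uv hX by force
      qed
    qed
  qed
  ultimately show ?thesis by linarith
qed

theorem theorem3:
  fixes V :: "'a set" and E E1 E2 :: "'a set set" and n :: nat
    and \<phi> :: "'a \<Rightarrow> real ^ 3" and P Q :: coord_plane
  assumes "connected_graph V E"
    and "card V = n" and "n \<ge> 3"
    and "inj_on \<phi> V"
    and "P \<noteq> Q"
    and "E = E1 \<union> E2"
    and "inj_on (plane_proj P \<circ> \<phi>) V" and "inj_on (plane_proj Q \<circ> \<phi>) V"
    and "straight_line_embedding V E1 (plane_proj P \<circ> \<phi>)"
    and "straight_line_embedding V E2 (plane_proj Q \<circ> \<phi>)"
  shows "card E \<le> 6 * n - 15"
proof -
  have g: "simple_graph V (E1 \<union> E2)"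
    using assms(1,6) by (simp add: connected_graph_def)
  have n: "card V \<ge> 3" using assms by simp
  have "simple_graph V E1" "simple_graph V E2" using g by (auto simp: simple_graph_def)
  hence "crossing_free V E1 (plane_proj P \<circ> \<phi>)" "crossing_free V E2 (plane_proj Q \<circ> \<phi>)"
    using assms by (auto intro: straight_line_embedding_imp_crossing_free)
  \<comment> \<open>By the cyclic naming of the planes, the coordinate shared by \<open>P\<close>
    and \<open>Q\<close> is first in one projection and second in the other. Swapping the latter
    makes it first in both.\<close>
  note cf = this[unfolded comp_def] this[unfolded comp_def, THEN crossing_free_swap]
  note bound = card_union_of_two_crossing_free[OF g n]
  have "card (E1 \<union> E2) \<le> 6 * card V - 15"
  proof (cases P)
    case XY
    then consider "Q = YZ" | "Q = ZX" using \<open>P \<noteq> Q\<close> by (cases Q) auto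
    thus ?thesis by cases (use XY cf in \<open>auto intro: bound\<close>)
  next
    case YZ
    then consider "Q = XY" | "Q = ZX" using \<open>P \<noteq> Q\<close> by (cases Q) auto
    thus ?thesis by cases (use YZ cf in \<open>auto intro: bound\<close>)
  next
    case ZX
    then consider "Q = XY" | "Q = YZ" using \<open>P \<noteq> Q\<close> by (cases Q) auto
    thus ?thesis by cases (use ZX cf in \<open>auto intro: bound\<close>)
  qed
  thus ?thesis using assms by simp
qed

end
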